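(* Let $\varphi$ be an LTL formula over a finite set of propositional variables $V = I \cup O$ ($I \cap O = \emptyset$), let $X \subseteq O$ and $Y \subseteq I \cup O$, and let $A_\varphi$ be a nondeterministic Büchi automaton over the alphabet $\Sigma = 2^V$ with $L(A_\varphi) = L(\varphi)$ in which every state and every transition lies on some accepting run. Then $X$ is dependent on $Y$ in $\varphi$ if and only if $X$ is automata dependent on $Y$ in $A_\varphi$.
   Context: Letters of $\Sigma = 2^V$ are assignments to $V$. For a letter $a$ and $Z \subseteq V$, $a.Z$ denotes the restriction (projection) of $a$ to $Z$. For an infinite word $w = w_0 w_1 \cdots$, $w[0,i] = w_0\cdots w_i$, and $w[0,-1]$ is the empty word. $L(\varphi) \subseteq \Sigma^\omega$ is the set of infinite words satisfying $\varphi$. Dependency in LTL: $X$ is dependent on $Y$ in $\varphi$ if for every $w, w' \in L(\varphi)$ and every $i \ge 0$, if $w[0,i-1] = w'[0,i-1]$ and $w_i.Y = w'_i.Y$ then $w_i.X = w'_i.X$. An NBA is $A = (\Sigma, Q, \delta, q_0, F)$ with $\delta : Q \times \Sigma \to 2^Q$; a run is a path from $q_0$, accepting if it visits $F$ infinitely often; $L(A)$ is the set of words having an accepting run. A pair of states $(s,s')$ is compatible in $A$ if there is a finite word $u \in \Sigma^*$ with runs from $q_0$ to $s$ and from $q_0$ to $s'$ both reading $u$. Automata dependency: $X$ is automata dependent on $Y$ in $A$ if for every compatible pair $(s,s')$ and all letters $\sigma, \sigma' \in \Sigma$ with $\sigma.Y = \sigma'.Y$ and $\sigma.X \neq \sigma'.X$,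 it is not the case that both $\delta(s,\sigma) \neq \emptyset$ and $\delta(s',\sigma') \neq \emptyset$. *)

theory Defs
  imports "HOL-Library.Omega_Words_Fun"
begin

text \<open>
  An assignment to \<open>V\<close> is represented by the set of variables of \<open>V\<close> that it makes true, so the
  alphabet of all assignments is \<open>Pow V\<close> and the projection of a letter \<open>a\<close> to \<open>Z \<subseteq> V\<close> is \<open>a \<inter> Z\<close>.
  The finite word \<open>w[0,i-1]\<close> is \<open>prefix i w\<close>, which is empty for \<open>i = 0\<close>.
\<close>

definition proj :: "'v set \<Rightarrow> 'v set \<Rightarrow> 'v set" where
  "proj a Z = a \<inter> Z"

definition omega_words :: "'a set \<Rightarrow> 'a word set" where
  "omega_words S = {w. \<forall>i. w i \<in> S}"

text \<open>
  False, implication, and the temporal operators eventually, globally and release are the usual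
  derived forms.
\<close>

datatype (atoms: 'v) ltl =
    LTrue
  | LProp 'v
  | LNot "'v ltl"
  | LAnd "'v ltl" "'v ltl"
  | LOr "'v ltl" "'v ltl"
  | LNext "'v ltl"
  | LUntil "'v ltl" "'v ltl"

fun ltl_sat :: "'v set word \<Rightarrow> 'v ltl \<Rightarrow> bool" where
  "ltl_sat w LTrue \<longleftrightarrow> True"
| "ltl_sat w (LProp p) \<longleftrightarrow> p \<in> w 0"
| "ltl_sat w (LNot f) \<longleftrightarrow> \<not> ltl_sat w f"
| "ltl_sat w (LAnd f g) \<longleftrightarrow> ltl_sat w f \<and> ltl_sat w g"
| "ltl_sat w (LOr f g) \<longleftrightarrow> ltl_sat w f \<or> ltl_sat w g"
| "ltl_sat w (LNext f) \<longleftrightarrow> ltl_sat (suffix 1 w) f"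
| "ltl_sat w (LUntil f g) \<longleftrightarrow>
     (\<exists>j. ltl_sat (suffix j w) g \<and> (\<forall>k<j. ltl_sat (suffix k w) f))"

definition ltl_language :: "'v set \<Rightarrow> 'v ltl \<Rightarrow> 'v set word set" where
  "ltl_language V f = {w \<in> omega_words (Pow V). ltl_sat w f}"

definition ltl_dependent :: "'v set \<Rightarrow> 'v ltl \<Rightarrow> 'v set \<Rightarrow> 'v set \<Rightarrow> bool" where
  "ltl_dependent V f X Y \<longleftrightarrow>
     (\<forall>w \<in> ltl_language V f. \<forall>w' \<in> ltl_language V f. \<forall>i.
        prefix i w = prefix i w' \<and> proj (w i) Y = proj (w' i) Y \<longrightarrow>
        proj (w i) X = proj (w' i) X)"

record ('a, 'q) nba =
  alphabet :: "'a set"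
  states :: "'q set"
  delta :: "'q \<Rightarrow> 'a \<Rightarrow> 'q set"
  init :: 'q
  accept :: "'q set"

text \<open>
  The values of \<open>delta\<close> outside \<open>states A\<close> and \<open>alphabet A\<close> are irrelevant: runs start in
  \<open>init A\<close> and only read words over the alphabet.
\<close>

definition is_nba :: "('a, 'q) nba \<Rightarrow> bool" where
  "is_nba A \<longleftrightarrow>
     finite (alphabet A) \<and> finite (states A) \<and>
     init A \<in> states A \<and> accept A \<subseteq> states A \<and>
     (\<forall>q \<in> states A. \<forall>a \<in> alphabet A. delta A q a \<subseteq> states A)"

definition nba_run :: "('a, 'q) nba \<Rightarrow> 'a word \<Rightarrow> 'q word \<Rightarrow> bool" where
  "nba_run A w r \<longleftrightarrow>
     w \<in> omega_words (alphabet A) \<and> r 0 = init A \<and> (\<forall>i. r (Suc i) \<in> delta A (r i) (w i))"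

definition accepting_run :: "('a, 'q) nba \<Rightarrow> 'a word \<Rightarrow> 'q word \<Rightarrow> bool" where
  "accepting_run A w r \<longleftrightarrow> nba_run A w r \<and> (\<exists>\<^sub>\<infinity>i. r i \<in> accept A)"

definition nba_language :: "('a, 'q) nba \<Rightarrow> 'a word set" where
  "nba_language A = {w. \<exists>r. accepting_run A w r}"

definition nba_trim :: "('a, 'q) nba \<Rightarrow> bool" where
  "nba_trim A \<longleftrightarrow>
     (\<forall>q \<in> states A. \<exists>w r i. accepting_run A w r \<and> r i = q) \<and>
     (\<forall>q \<in> states A. \<forall>a \<in> alphabet A. \<forall>q' \<in> delta A q a.
        \<exists>w r i. accepting_run A w r \<and> r i = q \<and> w i = a \<and> r (Suc i) = q')"

fun nba_path :: "('a, 'q) nba \<Rightarrow> 'q \<Rightarrow> 'a list \<Rightarrow> 'q \<Rightarrow> bool" where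
  "nba_path A q [] q' \<longleftrightarrow> q = q'"
| "nba_path A q (a # u) q' \<longleftrightarrow> (\<exists>p \<in> delta A q a. nba_path A p u q')"

definition compatible :: "('a, 'q) nba \<Rightarrow> 'q \<Rightarrow> 'q \<Rightarrow> bool" where
  "compatible A s s' \<longleftrightarrow>
     s \<in> states A \<and> s' \<in> states A \<and>
     (\<exists>u \<in> lists (alphabet A). nba_path A (init A) u s \<and> nba_path A (init A) u s')"

definition automata_dependent :: "('v set, 'q) nba \<Rightarrow> 'v set \<Rightarrow> 'v set \<Rightarrow> bool" where
  "automata_dependent A X Y \<longleftrightarrow>
     (\<forall>s s'. compatible A s s' \<longrightarrow>
        (\<forall>a \<in> alphabet A. \<forall>a' \<in> alphabet A.
           proj a Y = proj a' Y \<and> proj a X \<noteq> proj a' X \<longrightarrow>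
           \<not> (delta A s a \<noteq> {} \<and> delta A s' a' \<noteq> {})))"

end

theory Submission
  imports Defs
begin

text \<open>
  Two words of the language with a common prefix have runs that lead, after that prefix, to a
  compatible pair of states enabling the two next letters. Conversely, by trimness a transition
  enabled at a reachable state continues to an accepting run, so its tail can be attached to any
  path leading to that state; for a compatible pair and two enabled letters this produces two words
  of the language with a common prefix followed by these letters.
\<close>

text \<open>\<open>nba_path\<close> recurses on the first letter, while prefixes of an infinite word
  grow at the end; this form lets \<open>nba_run_path\<close> go by induction on the length.\<close>

lemma nba_path_snoc:
  "nba_path A q (u @ [a]) q' \<longleftrightarrow> (\<exists>p. nba_path A q u p \<and> q' \<in> delta A p a)"
  by (induction u arbitrary: q) auto

lemma nba_path_closed:
  assumes "is_nba A" "q \<in> states A" "u \<in> lists (alphabet A)" "nba_path A q u q'"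
  shows "q' \<in> states A"
  using assms(2-4)
proof (induction u arbitrary: q)
  case (Cons a u)
  then obtain p where "p \<in> delta A q a" "nba_path A p u q'" "a \<in> alphabet A" "u \<in> lists (alphabet A)"
    by auto
  moreover from this have "p \<in> states A"
    using assms(1) Cons.prems(1) unfolding is_nba_def by blast
  ultimately show ?case
    using Cons.IH by blast
qed simp

lemma prefix_in_lists:
  assumes "w \<in> omega_words S"
  shows "prefix i w \<in> lists S"
  using assms by (auto simp: omega_words_def subsequence_def)

lemma nba_run_path:
  assumes "nba_run A w r"
  shows "nba_path A (init A) (prefix i w) (r i)"
proof (induction i)
  case 0
  then show ?case using assms by (simp add: nba_run_def)
next
  case (Suc i)
  have "prefix (Suc i) w = prefix i w @ [w i]"
    by (simp add: subsequence_def)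
  with Suc show ?case
    using assms by (auto simp: nba_path_snoc nba_run_def)
qed

text \<open>The common prefix itself is the finite word that \<open>compatible\<close> asks for;
  \<open>nba_path_closed\<close> yields that both endpoints are states.\<close>

lemma nba_run_compatible:
  assumes "is_nba A" "nba_run A w r" "nba_run A w' r'" "prefix i w = prefix i w'"
  shows "compatible A (r i) (r' i)"
proof -
  have u: "prefix i w \<in> lists (alphabet A)"
    using assms(2) prefix_in_lists unfolding nba_run_def by blast
  have "nba_path A (init A) (prefix i w) (r i)"
    using nba_run_path[OF assms(2)] .
  moreover have "nba_path A (init A) (prefix i w) (r' i)"
    using nba_run_path[OF assms(3)] assms(4) by metis
  moreover have "init A \<in> states A"
    using assms(1) by (simp add: is_nba_def)
  ultimately show ?thesis
    using u nba_path_closed[OF assms(1)] unfolding compatible_def by blast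
qed

text \<open>Resetting \<open>init\<close> changes neither \<open>delta\<close> nor
  \<open>accept\<close>, and visiting \<open>accept A\<close> infinitely often is insensitive to
  dropping finitely many positions.\<close>

lemma accepting_run_suffix:
  assumes "accepting_run A w r"
  shows "accepting_run (A\<lparr>init := r i\<rparr>) (suffix i w) (suffix i r)"
proof -
  have "\<exists>\<^sub>\<infinity>n. r (i + n) \<in> accept A"
    unfolding INFM_nat
  proof
    fix m
    \<comment> \<open>The bound \<open>i + m\<close> ensures that \<open>n - i\<close> still exceeds
      \<open>m\<close>.\<close>
    obtain n where "n > i + m" "r n \<in> accept A"
      using assms unfolding accepting_run_def INFM_nat by blast
    then show "\<exists>n>m. r (i + n) \<in> accept A"
      by (intro exI[of _ "n - i"]) simp
  qed
  then show ?thesis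
    using assms by (simp add: accepting_run_def nba_run_def omega_words_def)
qed

text \<open>Putting \<open>q\<close> in front of an accepting run from \<open>p\<close> adds exactly
  the transition on \<open>a\<close>. The initial state varies so that
  \<open>nba_language_conc\<close> can iterate this along a path.\<close>

lemma nba_language_Cons:
  assumes "a \<in> alphabet A" "p \<in> delta A q a" "w \<in> nba_language (A\<lparr>init := p\<rparr>)"
  shows "[a] \<frown> w \<in> nba_language (A\<lparr>init := q\<rparr>)"
proof -
  obtain r where r: "accepting_run (A\<lparr>init := p\<rparr>) w r"
    using assms(3) by (auto simp: nba_language_def)
  let ?r = "[q] \<frown> r"
  have "nba_run (A\<lparr>init := q\<rparr>) ([a] \<frown> w) ?r"
    using r assms(1,2)
    by (auto simp: accepting_run_def nba_run_def omega_words_def conc_def gr0_conv_Suc)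
  moreover have "\<exists>\<^sub>\<infinity>i. ?r i \<in> accept A"
    unfolding INFM_nat
  proof
    fix m
    obtain n where "n > m" "r n \<in> accept A"
      using r unfolding accepting_run_def INFM_nat by auto
    then show "\<exists>n>m. ?r n \<in> accept A"
      by (intro exI[of _ "Suc n"]) (simp add: conc_def)
  qed
  ultimately show ?thesis
    by (auto simp: nba_language_def accepting_run_def)
qed

lemma nba_language_conc:
  assumes "u \<in> lists (alphabet A)" "nba_path A q u s" "w \<in> nba_language (A\<lparr>init := s\<rparr>)"
  shows "u \<frown> w \<in> nba_language (A\<lparr>init := q\<rparr>)"
  using assms(1,2)
proof (induction u arbitrary: q)
  case Nil
  then show ?case using assms(3) by simp
next
  case (Cons a u)
  then obtain p where "p \<in> delta A q a" "nba_path A p u s" "a \<in> alphabet A" "u \<in> lists (alphabet A)"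
    by auto
  then have "[a] \<frown> (u \<frown> w) \<in> nba_language (A\<lparr>init := q\<rparr>)"
    using Cons.IH nba_language_Cons by metis
  then show ?case
    using conc_conc[of "[a]" u w] by simp
qed

text \<open>The accepting run that trimness provides may reach \<open>s\<close> by a word other than
  \<open>u\<close>. Only its tail from \<open>s\<close> is kept, and \<open>u\<close> replaces its
  past.\<close>

lemma nba_trim_extend:
  assumes "nba_trim A" "s \<in> states A" "a \<in> alphabet A" "delta A s a \<noteq> {}"
    and "u \<in> lists (alphabet A)" "nba_path A (init A) u s"
  obtains w where "w \<in> nba_language A" "prefix (length u) w = u" "w (length u) = a"
proof -
  \<comment> \<open>The transition clause of trimness applies to any successor in
    \<open>delta A s a\<close>, so the run reads \<open>a\<close> on leaving
    \<open>s\<close>.\<close>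
  obtain v r i where v: "accepting_run A v r" "r i = s" "v i = a"
    using assms(1-4) unfolding nba_trim_def by blast
  have "suffix i v \<in> nba_language (A\<lparr>init := s\<rparr>)"
    using accepting_run_suffix[OF v(1), of i] v(2) by (auto simp: nba_language_def)
  \<comment> \<open>The path starts at \<open>init A\<close>, and setting \<open>init\<close> to its
    own value gives back \<open>A\<close>.\<close>
  then have "u \<frown> suffix i v \<in> nba_language A"
    using nba_language_conc[OF assms(5,6)] by simp
  then show thesis
    using v(3) by (intro that[of "u \<frown> suffix i v"]) simp_all
qed

theorem theorem2:
  fixes V I O_vars X Y :: "'v set"
    and \<phi> :: "'v ltl"
    and A :: "('v set, 'q) nba"
  assumes "finite V" and "V = I \<union> O_vars" and "I \<inter> O_vars = {}"
    and "atoms \<phi> \<subseteq> V"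
    and "X \<subseteq> O_vars" and "Y \<subseteq> I \<union> O_vars"
    and "is_nba A" and "alphabet A = Pow V"
    and "nba_language A = ltl_language V \<phi>"
    and "nba_trim A"
  shows "ltl_dependent V \<phi> X Y \<longleftrightarrow> automata_dependent A X Y"
proof
  assume dep: "ltl_dependent V \<phi> X Y"
  show "automata_dependent A X Y"
    unfolding automata_dependent_def
  proof (intro allI impI ballI notI)
    fix s s' a a'
    assume c: "compatible A s s'" and a: "a \<in> alphabet A" "a' \<in> alphabet A"
      and eq: "proj a Y = proj a' Y \<and> proj a X \<noteq> proj a' X"
      and ne: "delta A s a \<noteq> {} \<and> delta A s' a' \<noteq> {}"
    obtain u where st: "s \<in> states A" "s' \<in> states A" and u: "u \<in> lists (alphabet A)"
      and p: "nba_path A (init A) u s" "nba_path A (init A) u s'"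
      using c unfolding compatible_def by blast
    obtain w where w: "w \<in> nba_language A" "prefix (length u) w = u" "w (length u) = a"
      using nba_trim_extend[OF assms(10) st(1) a(1) _ u p(1)] ne by blast
    obtain w' where w': "w' \<in> nba_language A" "prefix (length u) w' = u" "w' (length u) = a'"
      using nba_trim_extend[OF assms(10) st(2) a(2) _ u p(2)] ne by blast
    have "w \<in> ltl_language V \<phi>" "w' \<in> ltl_language V \<phi>"
      using w(1) w'(1) assms(9) by simp_all
    moreover have "prefix (length u) w = prefix (length u) w'"
      using w(2) w'(2) by simp
    \<comment> \<open>Dependency is applied at position \<open>length u\<close>, where the next
      letters are \<open>a\<close> and \<open>a'\<close>.\<close>
    ultimately have "proj a X = proj a' X"
      using dep eq w(3) w'(3) unfolding ltl_dependent_def by blast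
    with eq show False by simp
  qed
next
  assume dep: "automata_dependent A X Y"
  show "ltl_dependent V \<phi> X Y"
    unfolding ltl_dependent_def
  proof (intro ballI allI impI)
    fix w w' i
    assume "w \<in> ltl_language V \<phi>" "w' \<in> ltl_language V \<phi>"
      and eq: "prefix i w = prefix i w' \<and> proj (w i) Y = proj (w' i) Y"
    then have "w \<in> nba_language A" "w' \<in> nba_language A"
      using assms(9) by simp_all
    then obtain r r' where r: "nba_run A w r" "nba_run A w' r'"
      by (auto simp: nba_language_def accepting_run_def)
    have "compatible A (r i) (r' i)"
      using nba_run_compatible[OF assms(7) r] eq by blast
    \<comment> \<open>The successors \<open>r (Suc i)\<close> and \<open>r' (Suc i)\<close> witness
      that both letters are enabled.\<close>
    moreover have "w i \<in> alphabet A" "w' i \<in> alphabet A"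
      and "delta A (r i) (w i) \<noteq> {}" "delta A (r' i) (w' i) \<noteq> {}"
      using r by (auto simp: nba_run_def omega_words_def)
    ultimately show "proj (w i) X = proj (w' i) X"
      using dep eq unfolding automata_dependent_def by blast
  qed
qed

end
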